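(* For positive integers $d_1,d_2,n_1,n_2$, let $\boldsymbol{x}_0,\dots,\boldsymbol{x}_{n_1-1}\in[0,1]^{d_1}$ and $\tilde{\boldsymbol{x}}_0,\dots,\tilde{\boldsymbol{x}}_{n_2-1}\in[0,1]^{d_2}$. Let $\boldsymbol{z}_0,\dots,\boldsymbol{z}_{N-1}\in[0,1]^{d_1+d_2}$, for $N=n_1n_2$, be the Cartesian product of those two point sets. If both the $\boldsymbol{x}_i$ and the $\tilde{\boldsymbol{x}}_i$ are NNLD points, then $\boldsymbol{z}_0,\dots,\boldsymbol{z}_{N-1}$ are NNLD points. Analogously, if both the $\boldsymbol{x}_i$ and the $\tilde{\boldsymbol{x}}_i$ are NPLD points, then $\boldsymbol{z}_0,\dots,\boldsymbol{z}_{N-1}$ are NPLD points.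
   Context: Point sets are multisets (points counted with multiplicity); the Cartesian product consists of the $N=n_1n_2$ points $(\boldsymbol{x}_i,\tilde{\boldsymbol{x}}_{i'})$ with $0\le i<n_1$, $0\le i'<n_2$, in any order. The local discrepancy of points $\boldsymbol{y}_0,\dots,\boldsymbol{y}_{n-1}\in[0,1]^d$ at $\boldsymbol{z}\in[0,1]^d$ is $$\delta(\boldsymbol{z})=\frac1n\#\Bigl\{0\le i<n:\boldsymbol{y}_i\in\prod_{j=1}^d[0,z_j)\Bigr\}-\prod_{j=1}^d z_j .$$ The points are NNLD (non-negative local discrepancy) if $\delta(\boldsymbol{z})\ge0$ for all $\boldsymbol{z}\in[0,1]^d$, and NPLD (non-positive local discrepancy) if $\delta(\boldsymbol{z})\le0$ for all $\boldsymbol{z}\in[0,1]^d$. *)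

theory Defs
  imports Complex_Main "HOL-Library.FuncSet"
begin

text \<open>
  A vector of dimension \<open>d\<close> is an extensional function on the index set \<open>{..<d}\<close>, so that dimensions
  are ordinary natural numbers and \<open>d1 + d2\<close> makes sense. A point set of size \<open>n\<close> is a
  sequence \<open>y\<close>, of which only \<open>y 0, \<dots>, y (n - 1)\<close> matter; repeated points are counted with multiplicity.
\<close>

definition unit_cube :: "nat \<Rightarrow> (nat \<Rightarrow> real) set" where
  "unit_cube d = ({..<d} \<rightarrow>\<^sub>E {0..1})"

definition anchored_box :: "nat \<Rightarrow> (nat \<Rightarrow> real) \<Rightarrow> (nat \<Rightarrow> real) set" where
  "anchored_box d z = (\<Pi>\<^sub>E j\<in>{..<d}. {0..<z j})"

definition local_discrepancy ::
    "nat \<Rightarrow> nat \<Rightarrow> (nat \<Rightarrow> nat \<Rightarrow> real) \<Rightarrow> (nat \<Rightarrow> real) \<Rightarrow> real" where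
  "local_discrepancy d n y z =
     real (card {i. i < n \<and> y i \<in> anchored_box d z}) / real n - (\<Prod>j<d. z j)"

definition NNLD :: "nat \<Rightarrow> nat \<Rightarrow> (nat \<Rightarrow> nat \<Rightarrow> real) \<Rightarrow> bool" where
  "NNLD d n y \<longleftrightarrow> (\<forall>z\<in>unit_cube d. local_discrepancy d n y z \<ge> 0)"

definition NPLD :: "nat \<Rightarrow> nat \<Rightarrow> (nat \<Rightarrow> nat \<Rightarrow> real) \<Rightarrow> bool" where
  "NPLD d n y \<longleftrightarrow> (\<forall>z\<in>unit_cube d. local_discrepancy d n y z \<le> 0)"

definition join_vec :: "nat \<Rightarrow> nat \<Rightarrow> (nat \<Rightarrow> real) \<Rightarrow> (nat \<Rightarrow> real) \<Rightarrow> nat \<Rightarrow> real" where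
  "join_vec d1 d2 u v = (\<lambda>j\<in>{..<d1 + d2}. if j < d1 then u j else v (j - d1))"

text \<open>
  The bijection \<open>\<sigma>\<close> expresses that \<open>z\<close> lists the \<open>n1 * n2\<close> points of the Cartesian product,
  with multiplicity, in an arbitrary order.
\<close>

definition is_cartesian_product ::
    "nat \<Rightarrow> nat \<Rightarrow> nat \<Rightarrow> nat \<Rightarrow> (nat \<Rightarrow> nat \<Rightarrow> real) \<Rightarrow> (nat \<Rightarrow> nat \<Rightarrow> real) \<Rightarrow>
      (nat \<Rightarrow> nat \<Rightarrow> real) \<Rightarrow> bool" where
  "is_cartesian_product d1 d2 n1 n2 x x' z \<longleftrightarrow>
     (\<exists>\<sigma>. bij_betw \<sigma> {..<n1 * n2} ({..<n1} \<times> {..<n2}) \<and>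
          (\<forall>k<n1 * n2. z k = join_vec d1 d2 (x (fst (\<sigma> k))) (x' (snd (\<sigma> k)))))"

end

theory Submission imports Defs begin

text \<open>
  An anchored box in dimension \<open>d1 + d2\<close> is a product of anchored boxes, so the fraction of product
  points inside it is the product \<open>p * q\<close> of the fractions for the two factors, and likewise its
  volume is a product \<open>a * b\<close>. All four numbers are nonnegative, so comparing \<open>p\<close> with \<open>a\<close>
  and \<open>q\<close> with \<open>b\<close> gives the comparison of \<open>p * q\<close> with \<open>a * b\<close>.
\<close>

lemma restrict_in_unit_cube:
  assumes "w \<in> unit_cube (d1 + d2)"
  shows "restrict w {..<d1} \<in> unit_cube d1"
    and "(\<lambda>j\<in>{..<d2}. w (d1 + j)) \<in> unit_cube d2"
  using assms by (auto simp: unit_cube_def PiE_iff)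

lemma all_less_add_iff:
  fixes m n :: nat
  shows "(\<forall>j<m + n. P j) \<longleftrightarrow> (\<forall>j<m. P j) \<and> (\<forall>j<n. P (m + j))"
proof -
  have "P j" if "\<forall>j<m. P j" "\<forall>j<n. P (m + j)" "j < m + n" for j
  proof (cases "j < m")
    case False
    then obtain i where "j = m + i"
      by (metis le_Suc_ex not_less)
    then show ?thesis
      using that by simp
  qed (use that in simp)
  then show ?thesis
    by auto
qed

text \<open>Membership is checked coordinate by coordinate, and the first \<open>d1\<close>
  coordinates only see \<open>u\<close>, the other \<open>d2\<close> only \<open>v\<close>. Joining
  discards the values of \<open>u\<close> and \<open>v\<close> outside their index ranges, so the
  extensionality that box membership demands of them is taken from the unit cube
  assumptions.\<close>

lemma join_vec_in_anchored_box_iff: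
  assumes "u \<in> unit_cube d1" and "v \<in> unit_cube d2"
  shows "join_vec d1 d2 u v \<in> anchored_box (d1 + d2) w \<longleftrightarrow>
    u \<in> anchored_box d1 (restrict w {..<d1}) \<and>
    v \<in> anchored_box d2 (\<lambda>j\<in>{..<d2}. w (d1 + j))"
proof -
  have "join_vec d1 d2 u v \<in> anchored_box (d1 + d2) w \<longleftrightarrow>
      (\<forall>j<d1 + d2. join_vec d1 d2 u v j \<in> {0..<w j})"
    by (simp add: anchored_box_def PiE_iff join_vec_def Ball_def)
  also have "\<dots> \<longleftrightarrow> (\<forall>j<d1. u j \<in> {0..<w j}) \<and> (\<forall>j<d2. v j \<in> {0..<w (d1 + j)})"
    unfolding all_less_add_iff by (simp add: join_vec_def)
  finally show ?thesis
    using assms by (simp add: anchored_box_def unit_cube_def PiE_iff Ball_def)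
qed

text \<open>Used to count indices rather than points, so that repeated points keep their
  multiplicity.\<close>

lemma bij_betw_Collect_mem:
  assumes "bij_betw f S T" and "U \<subseteq> T"
  shows "bij_betw f {s \<in> S. f s \<in> U} U"
proof -
  have "f ` {s \<in> S. f s \<in> U} = U"
    using assms unfolding bij_betw_def by blast
  then show ?thesis
    using assms(1) by (auto simp: bij_betw_def inj_on_def)
qed

text \<open>A product point lies in the box exactly when both of its components lie in the
  corresponding factor boxes. Hence the enumeration \<sigma> restricts to a bijection from the
  indices counted on the left onto \<open>?A \<times> ?B\<close>, whatever the order of the
  points.\<close>

lemma card_cartesian_product_in_box:
  assumes "\<And>i. i < n1 \<Longrightarrow> x i \<in> unit_cube d1"
    and "\<And>i. i < n2 \<Longrightarrow> x' i \<in> unit_cube d2"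
    and "is_cartesian_product d1 d2 n1 n2 x x' z"
  shows "card {k. k < n1 * n2 \<and> z k \<in> anchored_box (d1 + d2) w} =
    card {i. i < n1 \<and> x i \<in> anchored_box d1 (restrict w {..<d1})} *
    card {i. i < n2 \<and> x' i \<in> anchored_box d2 (\<lambda>j\<in>{..<d2}. w (d1 + j))}"
    (is "card ?C = card ?A * card ?B")
proof -
  obtain \<sigma> where \<sigma>: "bij_betw \<sigma> {..<n1 * n2} ({..<n1} \<times> {..<n2})"
    and z: "\<And>k. k < n1 * n2 \<Longrightarrow> z k = join_vec d1 d2 (x (fst (\<sigma> k))) (x' (snd (\<sigma> k)))"
    using assms(3) unfolding is_cartesian_product_def by blast
  have mem: "z k \<in> anchored_box (d1 + d2) w \<longleftrightarrow> \<sigma> k \<in> ?A \<times> ?B" if k: "k < n1 * n2" for k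
  proof -
    have "\<sigma> k \<in> {..<n1} \<times> {..<n2}"
      using \<sigma> k by (auto dest: bij_betwE)
    then have "fst (\<sigma> k) < n1" "snd (\<sigma> k) < n2"
      by auto
    then show ?thesis
      using assms(1,2) by (simp add: z[OF k] join_vec_in_anchored_box_iff mem_Times_iff)
  qed
  have C: "?C = {k \<in> {..<n1 * n2}. \<sigma> k \<in> ?A \<times> ?B}"
    by (intro Collect_cong conj_cong mem) simp_all
  have "bij_betw \<sigma> ?C (?A \<times> ?B)"
    unfolding C by (rule bij_betw_Collect_mem[OF \<sigma>]) auto
  then show ?thesis
    by (simp only: bij_betw_same_card card_cartesian_product)
qed

lemma prod_lessThan_add:
  fixes f :: "nat \<Rightarrow> 'a::comm_monoid_mult"
  shows "(\<Prod>j<m + n. f j) = (\<Prod>j<m. f j) * (\<Prod>j<n. f (m + j))"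
  by (induction n) (simp_all add: mult.assoc)

theorem lemma1:
  fixes d1 d2 n1 n2 N :: nat
    and x x' z :: "nat \<Rightarrow> nat \<Rightarrow> real"
  assumes "d1 > 0" and "d2 > 0" and "n1 > 0" and "n2 > 0"
    and "\<And>i. i < n1 \<Longrightarrow> x i \<in> unit_cube d1"
    and "\<And>i. i < n2 \<Longrightarrow> x' i \<in> unit_cube d2"
    and "N = n1 * n2"
    and "is_cartesian_product d1 d2 n1 n2 x x' z"
  shows "(NNLD d1 n1 x \<and> NNLD d2 n2 x' \<longrightarrow> NNLD (d1 + d2) N z) \<and>
         (NPLD d1 n1 x \<and> NPLD d2 n2 x' \<longrightarrow> NPLD (d1 + d2) N z)"
proof -
  define p q where
    "p = (\<lambda>w. real (card {i. i < n1 \<and> x i \<in> anchored_box d1 w}) / real n1)" and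
    "q = (\<lambda>w. real (card {i. i < n2 \<and> x' i \<in> anchored_box d2 w}) / real n2)"
  have nonneg: "0 \<le> p w" "0 \<le> q w" for w
    by (simp_all add: p_def q_def)
  have vol_nonneg: "0 \<le> (\<Prod>j<d. w j)" if "w \<in> unit_cube d" for d w
    using that by (intro prod_nonneg) (auto simp: unit_cube_def PiE_iff)
  \<comment> \<open>The volumes are written with the two pieces of \<open>w\<close> instead of
    \<open>w\<close> itself, so that they agree literally with the volumes in the discrepancies of
    the factors.\<close>
  have disc: "local_discrepancy (d1 + d2) N z w =
      p (restrict w {..<d1}) * q (\<lambda>j\<in>{..<d2}. w (d1 + j)) -
      (\<Prod>j<d1. restrict w {..<d1} j) * (\<Prod>j<d2. (\<lambda>j\<in>{..<d2}. w (d1 + j)) j)" for w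
    using assms(7) card_cartesian_product_in_box[OF assms(5,6,8), of w]
    by (simp add: local_discrepancy_def p_def q_def prod_lessThan_add)
  have "NNLD (d1 + d2) N z" if "NNLD d1 n1 x" "NNLD d2 n2 x'"
    unfolding NNLD_def
  proof
    fix w assume w: "w \<in> unit_cube (d1 + d2)"
    note uv = restrict_in_unit_cube[OF w]
    \<comment> \<open>Monotonicity of multiplication asks for one factor on each side to be
      nonnegative: here the second volume on the smaller side and the first fraction on the larger
      side.\<close>
    show "local_discrepancy (d1 + d2) N z w \<ge> 0"
      unfolding disc diff_ge_0_iff_ge
      using that(1)[unfolded NNLD_def, rule_format, OF uv(1)] that(2)[unfolded NNLD_def, rule_format, OF uv(2)]
        nonneg vol_nonneg[OF uv(2)]
      by (intro mult_mono) (simp_all only: local_discrepancy_def p_def q_def diff_ge_0_iff_ge diff_le_0_iff_le)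
  qed
  moreover have "NPLD (d1 + d2) N z" if "NPLD d1 n1 x" "NPLD d2 n2 x'"
    unfolding NPLD_def
  proof
    fix w assume w: "w \<in> unit_cube (d1 + d2)"
    note uv = restrict_in_unit_cube[OF w]
    \<comment> \<open>The sides are exchanged, so the nonnegative factors are now the second
      fraction and the first volume.\<close>
    show "local_discrepancy (d1 + d2) N z w \<le> 0"
      unfolding disc diff_le_0_iff_le
      using that(1)[unfolded NPLD_def, rule_format, OF uv(1)] that(2)[unfolded NPLD_def, rule_format, OF uv(2)]
        nonneg vol_nonneg[OF uv(1)]
      by (intro mult_mono) (simp_all only: local_discrepancy_def p_def q_def diff_ge_0_iff_ge diff_le_0_iff_le)
  qed
  ultimately show ?thesis
    by blast
qed

end
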